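(* Let $\Gamma$ be a chain of cycles of genus $g\geq 2$ with torsion profile $\underline{m}=(m_2,\dots,m_g)$. Let $r\in\mathbb{Z}_{\geq 1}$ and $d\in\mathbb{Z}$ with $r-d+g\geq 2$. If there exists an $\underline{m}$-displacement tableau $t:[(g-d+r)\times(r+1)]\to\{1,\dots,g\}$, then there exists an $\underline{m}$-displacement tableau $t':[(g-d+2r-1)\times 2]\to\{1,\dots,g\}$.
   Context: A chain of cycles of genus $g$ is the metric graph constructed as follows: take $g$ metric graphs $C_1,\dots,C_g$, each isometric to a circle; on each $C_i$ choose two distinct points $v_i,w_i$; for $1\leq i\leq g-1$ connect $w_i$ and $v_{i+1}$ by a line segment. Its torsion profile $\underline{m}=(m_2,\dots,m_g)$ is defined by: letting $l_i$ be the length of $C_i$ and $l(v_i,w_i)$ the length of the clockwise arc on $C_i$ from $v_i$ to $w_i$, $m_i=0$ if $l_i$ is an irrational multiple of $l(v_i,w_i)$, and otherwise $m_i$ is the minimal positive integer such that $m_i\,l(v_i,w_i)$ is an integer multiple of $l_i$. For positive integers $a,b$, $[a\times b]$ denotes $\{1,\dots,a\}\times\{1,\dots,b\}$. An $\underline{m}$-displacement tableau on $[a\times b]$ is a function $t:[a\times b]\to\{1,\dots,g\}$ such that (i) $t$ is strictly increasing in each coordinate when the other coordinate is fixed, and (ii) if $t(x,y)=t(x',y')$ then $x-y\equiv x'-y' \pmod{m_{t(x,y)}}$ (congruence modulo $0$ meaning equality; the condition is vacuous for the value $1$, which can only occur at $(1,1)$). *)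

theory Defs
  imports
    Complex_Main
    "HOL-Library.FuncSet"
    "HOL-Number_Theory.Cong"
    "Graph_Theory.Digraph"
begin

text \<open>
  A metric graph is given by a finite multigraph with a positive length for every edge.
  The direction of an arc is only a reference orientation of the corresponding segment; a length
  \<open>l e\<close> stands for the segment \<open>[0, l e]\<close> glued to the vertices \<open>tail \<Gamma> e\<close> and \<open>head \<Gamma> e\<close>.
\<close>

locale metric_graph = fin_digraph \<Gamma>
  for \<Gamma> :: "('a, 'e) pre_digraph" +
  fixes l :: "'e \<Rightarrow> real"
  assumes length_pos: "e \<in> arcs \<Gamma> \<Longrightarrow> 0 < l e"

text \<open>
  Two distinct points \<open>v i\<close>, \<open>w i\<close> cut the \<open>i\<close>-th circle into the clockwise arc \<open>p i\<close> from \<open>v i\<close> to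
  \<open>w i\<close> and the clockwise arc \<open>q i\<close> from \<open>w i\<close> back to \<open>v i\<close>. The segment \<open>s i\<close> connects \<open>w i\<close> to
  \<open>v (i + 1)\<close>.
\<close>

locale chain_of_cycles = metric_graph \<Gamma> l
  for \<Gamma> :: "('a, 'e) pre_digraph" and l :: "'e \<Rightarrow> real" +
  fixes g :: nat
    and v w :: "nat \<Rightarrow> 'a"
    and p q s :: "nat \<Rightarrow> 'e"
  assumes genus_pos: "1 \<le> g"
    and verts_eq: "verts \<Gamma> = v ` {1..g} \<union> w ` {1..g}"
    and verts_distinct: "inj_on v {1..g}" "inj_on w {1..g}" "v ` {1..g} \<inter> w ` {1..g} = {}"
    and arcs_eq: "arcs \<Gamma> = p ` {1..g} \<union> q ` {1..g} \<union> s ` {1..<g}"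
    and arcs_distinct:
      "inj_on p {1..g}" "inj_on q {1..g}" "inj_on s {1..<g}"
      "p ` {1..g} \<inter> q ` {1..g} = {}"
      "p ` {1..g} \<inter> s ` {1..<g} = {}"
      "q ` {1..g} \<inter> s ` {1..<g} = {}"
    and ends_p: "i \<in> {1..g} \<Longrightarrow> tail \<Gamma> (p i) = v i \<and> head \<Gamma> (p i) = w i"
    and ends_q: "i \<in> {1..g} \<Longrightarrow> tail \<Gamma> (q i) = w i \<and> head \<Gamma> (q i) = v i"
    and ends_s: "i \<in> {1..<g} \<Longrightarrow> tail \<Gamma> (s i) = w i \<and> head \<Gamma> (s i) = v (Suc i)"
begin

definition cycle_length :: "nat \<Rightarrow> real" where
  "cycle_length i = l (p i) + l (q i)"

definition clockwise_length :: "nat \<Rightarrow> real" where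
  "clockwise_length i = l (p i)"

definition torsion :: "nat \<Rightarrow> nat" where
  "torsion i =
     (if cycle_length i / clockwise_length i \<notin> \<rat> then 0
      else LEAST n. 0 < n \<and> (\<exists>k::int. of_nat n * clockwise_length i = of_int k * cycle_length i))"

text \<open>
  The profile \<open>(m\<^sub>2, \<dots>, m\<^sub>g)\<close> is a function of which only the values on \<open>{2..g}\<close> are meaningful.
\<close>

definition torsion_profile :: "(nat \<Rightarrow> nat) \<Rightarrow> bool" where
  "torsion_profile m \<longleftrightarrow> (\<forall>i\<in>{2..g}. m i = torsion i)"

end

lemma chain_of_cycles_exists:
  fixes a L b :: "nat \<Rightarrow> real"
  assumes "1 \<le> g" and "\<And>i. 0 < a i" and "\<And>i. a i < L i" and "\<And>i. 0 < b i"
  shows "\<exists>(\<Gamma> :: (nat \<times> bool, nat \<times> nat) pre_digraph) l v w p q s.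
           chain_of_cycles \<Gamma> l g v w p q s \<and>
           (\<forall>i\<in>{1..g}. l (p i) = a i \<and> l (p i) + l (q i) = L i) \<and>
           (\<forall>i\<in>{1..<g}. l (s i) = b i)"
proof -
  define v w :: "nat \<Rightarrow> nat \<times> bool" where "v i = (i, False)" and "w i = (i, True)" for i
  define p q s :: "nat \<Rightarrow> nat \<times> nat" where "p i = (i, 0)" and "q i = (i, 1)" and "s i = (i, 2)" for i
  define l :: "nat \<times> nat \<Rightarrow> real" where
    "l = (\<lambda>(i, j). if j = 0 then a i else if j = 1 then L i - a i else b i)"
  define \<Gamma> :: "(nat \<times> bool, nat \<times> nat) pre_digraph" where
    "\<Gamma> = \<lparr>verts = v ` {1..g} \<union> w ` {1..g}, arcs = p ` {1..g} \<union> q ` {1..g} \<union> s ` {1..<g},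
          tail = (\<lambda>(i, j). if j = 0 then v i else w i),
          head = (\<lambda>(i, j). if j = 0 then w i else if j = 1 then v i else v (Suc i))\<rparr>"
  have "chain_of_cycles \<Gamma> l g v w p q s"
    using assms
    by unfold_locales
      (auto simp: \<Gamma>_def l_def v_def w_def p_def q_def s_def inj_on_def image_iff)
  moreover have "\<forall>i\<in>{1..g}. l (p i) = a i \<and> l (p i) + l (q i) = L i"
    and "\<forall>i\<in>{1..<g}. l (s i) = b i"
    by (auto simp: l_def p_def q_def s_def)
  ultimately show ?thesis by blast
qed

definition box :: "int \<Rightarrow> int \<Rightarrow> (int \<times> int) set" where
  "box a b = {1..a} \<times> {1..b}"

text \<open>
  The value \<open>1\<close> can only occur at \<open>(1, 1)\<close>, so the congruence condition is imposed only for values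
  at least \<open>2\<close>, where \<open>m\<close> is meaningful. Congruence modulo \<open>0\<close> on \<^typ>\<open>int\<close> is equality.
\<close>

definition displacement_tableau ::
    "nat \<Rightarrow> (nat \<Rightarrow> nat) \<Rightarrow> int \<Rightarrow> int \<Rightarrow> (int \<times> int \<Rightarrow> nat) \<Rightarrow> bool" where
  "displacement_tableau g m a b t \<longleftrightarrow>
     t \<in> box a b \<rightarrow> {1..g} \<and>
     (\<forall>x x' y. (x, y) \<in> box a b \<and> (x', y) \<in> box a b \<and> x < x' \<longrightarrow> t (x, y) < t (x', y)) \<and>
     (\<forall>x y y'. (x, y) \<in> box a b \<and> (x, y') \<in> box a b \<and> y < y' \<longrightarrow> t (x, y) < t (x, y')) \<and>
     (\<forall>x y x' y'. (x, y) \<in> box a b \<and> (x', y') \<in> box a b \<and> t (x, y) = t (x', y') \<and> 2 \<le> t (x, y) \<longrightarrow>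
        [x - y = x' - y'] (mod int (m (t (x, y)))))"

end

theory Submission
  imports Defs
begin

text \<open>
  Induct on \<open>a + b\<close> to turn a tableau \<open>t\<close> on \<open>[a \<times> b]\<close> with \<open>a, b \<ge> 2\<close> into one on
  \<open>[(a + b - 2) \<times> 2]\<close> that only uses values of \<open>t\<close>. Up to transposition \<open>b \<ge> 3\<close> and
  \<open>t (2, 1) \<le> t (1, 2)\<close>. Deleting the cells with \<open>y = 1\<close> leaves a tableau on \<open>[a \<times> (b - 1)]\<close> with
  values at least \<open>t (1, 2)\<close>; to the resulting tableau on \<open>[(a + b - 3) \<times> 2]\<close> one prepends the
  pair \<open>t (1, 1) < t (2, 1)\<close>. The only repetition that this can create is
  \<open>t (2, 1) = t (1, 2)\<close> at \<open>(1, 2)\<close> and \<open>(2, 1)\<close>, cells that differ by \<open>2\<close> in \<open>x - y\<close>, exactly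
  as the two cells of \<open>t\<close> do.
\<close>

lemma displacement_tableauI:
  assumes "\<And>x y. (x, y) \<in> box a b \<Longrightarrow> 1 \<le> t (x, y) \<and> t (x, y) \<le> g"
    and "\<And>x x' y. (x, y) \<in> box a b \<Longrightarrow> (x', y) \<in> box a b \<Longrightarrow> x < x' \<Longrightarrow> t (x, y) < t (x', y)"
    and "\<And>x y y'. (x, y) \<in> box a b \<Longrightarrow> (x, y') \<in> box a b \<Longrightarrow> y < y' \<Longrightarrow> t (x, y) < t (x, y')"
    and "\<And>x y x' y'. (x, y) \<in> box a b \<Longrightarrow> (x', y') \<in> box a b \<Longrightarrow> t (x, y) = t (x', y') \<Longrightarrow>
           2 \<le> t (x, y) \<Longrightarrow> [x - y = x' - y'] (mod int (m (t (x, y))))"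
  shows "displacement_tableau g m a b t"
  unfolding displacement_tableau_def
proof (intro conjI)
  show "t \<in> box a b \<rightarrow> {1..g}" using assms(1) by auto
qed (use assms(2-) in blast)+

lemma displacement_tableauD:
  assumes "displacement_tableau g m a b t"
  shows "(x, y) \<in> box a b \<Longrightarrow> 1 \<le> t (x, y) \<and> t (x, y) \<le> g"
    and "(x, y) \<in> box a b \<Longrightarrow> (x', y) \<in> box a b \<Longrightarrow> x < x' \<Longrightarrow> t (x, y) < t (x', y)"
    and "(x, y) \<in> box a b \<Longrightarrow> (x, y') \<in> box a b \<Longrightarrow> y < y' \<Longrightarrow> t (x, y) < t (x, y')"
    and "(x, y) \<in> box a b \<Longrightarrow> (x', y') \<in> box a b \<Longrightarrow> t (x, y) = t (x', y') \<Longrightarrow>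
           2 \<le> t (x, y) \<Longrightarrow> [x - y = x' - y'] (mod int (m (t (x, y))))"
  using assms unfolding displacement_tableau_def
  by (force, blast, blast, blast)

text \<open>Swapping coordinates negates every difference \<open>x - y\<close>, and negation
  preserves congruences.\<close>

lemma displacement_tableau_transpose:
  assumes "displacement_tableau g m a b t"
  shows "displacement_tableau g m b a (t \<circ> prod.swap)"
proof (rule displacement_tableauI)
  fix x y x' y' :: int
  assume "(x, y) \<in> box b a" "(x', y') \<in> box b a"
    and "(t \<circ> prod.swap) (x, y) = (t \<circ> prod.swap) (x', y')" "2 \<le> (t \<circ> prod.swap) (x, y)"
  then have "[y - x = y' - x'] (mod int (m (t (y, x))))"
    by (intro displacement_tableauD(4)[OF assms]) (auto simp: box_def)
  then have "[- (y - x) = - (y' - x')] (mod int (m (t (y, x))))"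
    by (simp only: cong_minus_minus_iff)
  then show "[x - y = x' - y'] (mod int (m ((t \<circ> prod.swap) (x, y))))"
    by simp
qed (use displacement_tableauD(1-3)[OF assms] in \<open>auto simp: box_def\<close>)

text \<open>Walk from \<open>(1, 1)\<close> to \<open>(1, y)\<close> and then to
  \<open>(x, y)\<close>: each nontrivial leg raises the value.\<close>

lemma displacement_tableau_ge_corner:
  assumes t: "displacement_tableau g m a b t" and xy: "(x, y) \<in> box a b"
  shows "t (1, 1) \<le> t (x, y)"
    and "(x, y) \<noteq> (1, 1) \<Longrightarrow> t (1, 1) < t (x, y)"
proof -
  have cells: "(1, 1) \<in> box a b" "(1, y) \<in> box a b" and "1 \<le> x" "1 \<le> y"
    using xy by (auto simp: box_def)
  show strict: "t (1, 1) < t (x, y)" if "(x, y) \<noteq> (1, 1)"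
    using displacement_tableauD(2)[OF t cells(2) xy] displacement_tableauD(3)[OF t cells(1,2)]
      that \<open>1 \<le> x\<close> \<open>1 \<le> y\<close> by (cases "x = 1"; cases "y = 1") force+
  show "t (1, 1) \<le> t (x, y)"
    using strict by fastforce
qed

lemma displacement_tableau_delete_row:
  assumes "displacement_tableau g m a b t"
  shows "displacement_tableau g m a (b - 1) (\<lambda>(x, y). t (x, y + 1))"
proof (rule displacement_tableauI)
  fix x y x' y' :: int
  assume "(x, y) \<in> box a (b - 1)" "(x', y') \<in> box a (b - 1)"
    and "(case (x, y) of (x, y) \<Rightarrow> t (x, y + 1)) = (case (x', y') of (x, y) \<Rightarrow> t (x, y + 1))"
    and "2 \<le> (case (x, y) of (x, y) \<Rightarrow> t (x, y + 1))"
  then have "[x - (y + 1) = x' - (y' + 1)] (mod int (m (t (x, y + 1))))"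
    by (intro displacement_tableauD(4)[OF assms]) (auto simp: box_def)
  then have "[x - (y + 1) + 1 = x' - (y' + 1) + 1] (mod int (m (t (x, y + 1))))"
    by (rule cong_add) simp
  then show "[x - y = x' - y'] (mod int (m (case (x, y) of (x, y) \<Rightarrow> t (x, y + 1))))"
    by simp
qed (use displacement_tableauD(1-3)[OF assms] in \<open>auto simp: box_def\<close>)

text \<open>Apart from its corner, \<open>t\<close> only takes values above \<open>t (1, 1)\<close>,
  hence above \<open>u\<close> and \<open>w\<close>. So a new repetition can only pair
  \<open>w\<close> at \<open>(1, 2)\<close> with the old corner, now at \<open>(2, 1)\<close>. There
  \<open>x - y\<close> is \<open>-1\<close> and \<open>1\<close>, which is why \<open>dvd\<close>
  asks for a divisor of \<open>2\<close>.\<close>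

lemma displacement_tableau_prepend:
  assumes t: "displacement_tableau g m n 2 t" and "1 \<le> n"
    and "1 \<le> u" "u < w" "w \<le> t (1, 1)"
    and dvd: "w = t (1, 1) \<Longrightarrow> int (m w) dvd 2"
  shows "displacement_tableau g m (n + 1) 2
           (\<lambda>(x, y). if x = 1 then (if y = 1 then u else w) else t (x - 1, y))"
    (is "displacement_tableau g m _ _ ?t'")
proof -
  have corner: "(1, 1) \<in> box n 2" using \<open>1 \<le> n\<close> by (simp add: box_def)
  have "w \<le> g" using displacement_tableauD(1)[OF t corner] \<open>w \<le> t (1, 1)\<close> by linarith
  \<comment> \<open>After the shift by one, the corner of \<open>t\<close> sits at
    \<open>(2, 1)\<close>.\<close>
  have first: "t (1, 1) \<le> t (x - 1, y)" "(x, y) \<noteq> (2, 1) \<Longrightarrow> t (1, 1) < t (x - 1, y)"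
    if "(x, y) \<in> box (n + 1) 2" "x \<noteq> 1" for x y
    using displacement_tableau_ge_corner[OF t, of "x - 1" y] that by (auto simp: box_def)
  show ?thesis
  proof (rule displacement_tableauI)
    fix x y :: int
    assume "(x, y) \<in> box (n + 1) 2"
    then show "1 \<le> ?t' (x, y) \<and> ?t' (x, y) \<le> g"
      using displacement_tableauD(1)[OF t, of "x - 1" y] \<open>1 \<le> u\<close> \<open>u < w\<close> \<open>w \<le> g\<close>
      by (auto simp: box_def)
  next
    fix x x' y :: int
    assume A: "(x, y) \<in> box (n + 1) 2" "(x', y) \<in> box (n + 1) 2" "x < x'"
    then have "x' \<noteq> 1" and "1 \<le> x" and y: "y = 1 \<or> y = 2" by (auto simp: box_def)
    show "?t' (x, y) < ?t' (x', y)"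
    proof (cases "x = 1")
      case True
      then show ?thesis
        using first[OF A(2) \<open>x' \<noteq> 1\<close>] \<open>x' \<noteq> 1\<close> y \<open>u < w\<close> \<open>w \<le> t (1, 1)\<close> by auto
    next
      case False
      then show ?thesis
        using displacement_tableauD(2)[OF t, of "x - 1" y "x' - 1"] A \<open>x' \<noteq> 1\<close>
        by (auto simp: box_def)
    qed
  next
    fix x y y' :: int
    assume "(x, y) \<in> box (n + 1) 2" "(x, y') \<in> box (n + 1) 2" "y < y'"
    then show "?t' (x, y) < ?t' (x, y')"
      using displacement_tableauD(3)[OF t, of "x - 1" y y'] \<open>u < w\<close> by (auto simp: box_def)
  next
    \<comment> \<open>Stated with the prepended cell first; the opposite order follows by symmetry
      of the equation.\<close>
    have repeat: "x = 1 \<and> y = 2 \<and> x' = 2 \<and> y' = 1 \<and> w = t (1, 1)"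
      if "(x, y) \<in> box (n + 1) 2" "(x', y') \<in> box (n + 1) 2" "?t' (x, y) = ?t' (x', y')"
        "x = 1" "x' \<noteq> 1" for x y x' y' :: int
      using that first[OF that(2,5)] \<open>u < w\<close> \<open>w \<le> t (1, 1)\<close>
      by (cases "(x', y') = (2, 1)") (auto simp: box_def split: if_splits)
    fix x y x' y' :: int
    assume A: "(x, y) \<in> box (n + 1) 2" "(x', y') \<in> box (n + 1) 2"
      "?t' (x, y) = ?t' (x', y')" "2 \<le> ?t' (x, y)"
    consider "x = 1" "x' = 1" | "x = 1" "x' \<noteq> 1" | "x \<noteq> 1" "x' = 1" | "x \<noteq> 1" "x' \<noteq> 1"
      by blast
    then show "[x - y = x' - y'] (mod int (m (?t' (x, y))))"
    proof cases
      case 1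
      with A \<open>u < w\<close> have "y = y'" by (auto simp: box_def split: if_splits)
      with 1 show ?thesis by simp
    next
      case 2
      from repeat[OF A(1-3) this] show ?thesis
        using dvd by (simp add: cong_iff_dvd_diff)
    next
      case 3
      from repeat[OF A(2,1) A(3)[symmetric] this(2,1)] show ?thesis
        using dvd by (simp add: cong_iff_dvd_diff)
    next
      case 4
      then have "[(x - 1) - y = (x' - 1) - y'] (mod int (m (t (x - 1, y))))"
        using A by (intro displacement_tableauD(4)[OF t]) (auto simp: box_def)
      then have "[(x - 1) - y + 1 = (x' - 1) - y' + 1] (mod int (m (t (x - 1, y))))"
        by (rule cong_add) simp
      then show ?thesis using 4 by simp
    qed
  qed
qed

text \<open>The inclusion of images strengthens the induction: it bounds the corner of the tableau
  supplied by the induction hypothesis from below.\<close>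

lemma displacement_tableau_two_rows:
  assumes "displacement_tableau g m a b t" and "2 \<le> a" and "2 \<le> b"
  shows "\<exists>t'. displacement_tableau g m (a + b - 2) 2 t' \<and> t' ` box (a + b - 2) 2 \<subseteq> t ` box a b"
  using assms
proof (induction "nat (a + b)" arbitrary: a b t rule: less_induct)
  case less
  \<comment> \<open>The target shape depends only on the sum of the sides, so this step is stated
    for any \<open>c\<close>, \<open>e\<close> with that sum and can serve both \<open>t\<close> and
    its transpose.\<close>
  have reduce: "\<exists>t'. displacement_tableau g m (c + e - 2) 2 t' \<and>
                     t' ` box (c + e - 2) 2 \<subseteq> f ` box c e"
    if f: "displacement_tableau g m c e f" and ce: "2 \<le> c" "3 \<le> e" "c + e = a + b"
      and le: "f (2, 1) \<le> f (1, 2)" for c e f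
  proof -
    let ?f = "\<lambda>(x, y). f (x, y + 1)" and ?n = "c + (e - 1) - 2"
    have del: "displacement_tableau g m c (e - 1) ?f"
      by (rule displacement_tableau_delete_row[OF f])
    \<comment> \<open>Here \<open>3 \<le> e\<close> keeps the remaining side \<open>e - 1\<close> at
      least \<open>2\<close>, while the sum drops by one.\<close>
    obtain h where h: "displacement_tableau g m ?n 2 h"
      and h_im: "h ` box ?n 2 \<subseteq> ?f ` box c (e - 1)"
      using less.hyps[OF _ del] ce by auto
    have cells: "(1, 1) \<in> box c e" "(2, 1) \<in> box c e" "(1, 2) \<in> box c e" "(1, 1) \<in> box ?n 2"
      using ce by (auto simp: box_def)
    have u: "1 \<le> f (1, 1)" and uw: "f (1, 1) < f (2, 1)"
      using displacement_tableauD(1)[OF f cells(1)] displacement_tableauD(2)[OF f cells(1,2)]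
      by simp_all
    obtain x y where "(x, y) \<in> box c (e - 1)" and "h (1, 1) = ?f (x, y)"
      using h_im cells(4) by fast
    then have ge: "f (1, 2) \<le> h (1, 1)"
      using displacement_tableau_ge_corner(1)[OF del, of x y] by simp
    have dvd: "int (m (f (2, 1))) dvd 2" if "f (2, 1) = h (1, 1)"
    proof -
      \<comment> \<open>The chain \<open>f (2, 1) \<le> f (1, 2) \<le> h (1, 1)\<close> collapses.
        The common value exceeds \<open>f (1, 1) \<ge> 1\<close>, so the congruence condition
        applies to it.\<close>
      have "f (2, 1) = f (1, 2)" using that le ge by simp
      then have "[2 - 1 = 1 - 2 :: int] (mod int (m (f (2, 1))))"
        using displacement_tableauD(4)[OF f cells(2,3)] u uw by simp
      then show ?thesis by (simp add: cong_iff_dvd_diff)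
    qed
    let ?t' = "\<lambda>(x, y). if x = 1 then (if y = 1 then f (1, 1) else f (2, 1)) else h (x - 1, y)"
    have "displacement_tableau g m (?n + 1) 2 ?t'"
      using displacement_tableau_prepend[OF h _ u uw _ dvd] ce le ge by simp
    moreover have "?t' (x, y) \<in> f ` box c e" if "(x, y) \<in> box (?n + 1) 2" for x y
    proof (cases "x = 1")
      case True
      then show ?thesis using cells by simp
    next
      case False
      then have "h (x - 1, y) \<in> ?f ` box c (e - 1)"
        using h_im that by (auto simp: box_def)
      then show ?thesis using False by (force simp: box_def)
    qed
    moreover have "?n + 1 = c + e - 2" by simp
    ultimately show ?thesis
      by (metis (no_types, lifting) image_subsetI surj_pair)
  qed
  have transposed: "displacement_tableau g m b a (t \<circ> prod.swap)"
    by (rule displacement_tableau_transpose[OF less.prems(1)])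
  have image: "(t \<circ> prod.swap) ` box b a = t ` box a b"
    by (simp only: image_comp[symmetric] box_def product_swap)
  \<comment> \<open>If a side is \<open>2\<close>, then \<open>t\<close> or its transpose already
    has the target shape. Otherwise both sides are at least \<open>3\<close> and comparing the two
    neighbours of the corner selects the orientation.\<close>
  consider "b = 2" | "a = 2" | "3 \<le> b" "t (2, 1) \<le> t (1, 2)" | "3 \<le> a" "t (1, 2) \<le> t (2, 1)"
    using less.prems(2,3) by linarith
  then show ?case
  proof cases
    case 1
    then show ?thesis using less.prems(1) by auto
  next
    case 2
    then show ?thesis
      using transposed image by (intro exI[of _ "t \<circ> prod.swap"] conjI) (simp_all only: add_diff_cancel_left' order_refl)
  next
    case 3
    then show ?thesis using reduce less.prems by blast
  next
    case 4
    then show ?thesis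
      using reduce[OF transposed] image less.prems(3) by (simp add: add.commute)
  qed
qed

theorem theorem2:
  fixes \<Gamma> :: "('a, 'e) pre_digraph" and l :: "'e \<Rightarrow> real"
    and g :: nat and v w :: "nat \<Rightarrow> 'a" and p q s :: "nat \<Rightarrow> 'e"
    and m :: "nat \<Rightarrow> nat" and r d :: int
  assumes "chain_of_cycles \<Gamma> l g v w p q s"
    and "g \<ge> 2"
    and "chain_of_cycles.torsion_profile l g p q m"
    and "r \<ge> 1"
    and "r - d + int g \<ge> 2"
    and "\<exists>t. displacement_tableau g m (int g - d + r) (r + 1) t"
  shows "\<exists>t'. displacement_tableau g m (int g - d + 2 * r - 1) 2 t'"
proof -
  obtain t where "displacement_tableau g m (int g - d + r) (r + 1) t"
    using assms(6) by blast
  \<comment> \<open>The bounds on \<open>r - d + int g\<close> and \<open>r\<close> give sides at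
    least \<open>2\<close>: the first is \<open>r - d + int g\<close> and the second is
    \<open>r + 1\<close>.\<close>
  then obtain t' where "displacement_tableau g m ((int g - d + r) + (r + 1) - 2) 2 t'"
    using displacement_tableau_two_rows[of g m "int g - d + r" "r + 1" t] assms(4,5) by auto
  moreover have "(int g - d + r) + (r + 1) - 2 = int g - d + 2 * r - 1" by simp
  ultimately show ?thesis by metis
qed

end
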